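(* Let $(G,K)$ be a hypergroup Gelfand pair and let $\gamma:\widehat{G^\natural}\to\mathbb{R}_+=[0,\infty)$ be a measurable function. If $s>\sigma>0$ are real numbers, then $H^{s,\natural}_\gamma(G)$ is continuously embedded in $H^{\sigma,\natural}_\gamma(G)$, with $$\|f\|_{H^{\sigma,\natural}_\gamma}\leqslant\|f\|_{H^{s,\natural}_\gamma}\qquad\text{for all } f\in H^{s,\natural}_\gamma(G).$$
   Context: Hypergroups. Let $G$ be a locally compact Hausdorff space, $M(G)$ its Radon measures, $M_b(G)$ the bounded Radon measures, $\delta_x$ the point mass at $x$, and $\mathfrak{C}(G)$ the set of compact subspaces of $G$ with the Michael topology. $G$ is a hypergroup if: (1) there is a binary operation $\ast$ (convolution) turning $M_b(G)$ into an associative algebra such that $(\mu,\nu)\mapsto\mu\ast\nu$ is continuous for the cone topology (on nonnegative bounded measures, the weakest topology making $\mu\mapsto\int f\,d\mu$ continuous for $f=1$ and for every continuous compactly supported $f$), $\delta_x\ast\delta_y$ is a probability measure with compact support for all $x,y\in G$, and $(x,y)\mapsto\mathrm{supp}(\delta_x\ast\delta_y)$ is continuous from $G\times G$ to $\mathfrak{C}(G)$; (2) there is a unique $e\in G$ with $\delta_x\ast\delta_e=\delta_e\ast\delta_x=\delta_x$ for all $x$; (3) there is an involutive homeomorphism $x\mapsto x^\diamond$ of $G$ with $(\delta_x\ast\delta_y)^\diamond=\delta_{y^\diamond}\ast\delta_{x^\diamond}$, where $\mu^\diamond(f)=\mu(f^\diamond)$ and $f^\diamond(x)=f(x^\diamond)$;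 (4) $z\in\mathrm{supp}(\delta_x\ast\delta_y)\iff x\in\mathrm{supp}(\delta_z\ast\delta_{y^\diamond})$. A subhypergroup is a nonempty closed subset $H$ with $x^\diamond\in H$ and $\mathrm{supp}(\delta_x\ast\delta_y)\subset H$ for all $x,y\in H$. Write $f(x\ast y)=\int_G f\,d(\delta_x\ast\delta_y)$, and similarly for more factors; for measures, $(\mu\ast\nu)(f)=\int_G\int_G f(x\ast y)\,d\mu(x)\,d\nu(y)$. Gelfand pairs. $G$ is assumed to carry a left Haar measure $dx$ (a nonzero nonnegative Radon measure with $\int_G f(y\ast x)\,dx=\int_G f(x)\,dx$ for all $y\in G$ and all continuous compactly supported $f$), and $K$ is a compact subhypergroup of $G$ with normalized Haar measure $dk$. A function $f$ is $K$-bi-invariant if $f(k_1\ast x\ast k_2)=f(x)$ for all $k_1,k_2\in K$, $x\in G$ (for $L^p$ functions, understood almost everywhere in $x$). Put $f^\natural(x)=\int_K\int_K f(k_1\ast x\ast k_2)\,dk_1\,dk_2$; a measure $\mu$ is $K$-bi-invariant if $\mu(f^\natural)=\mu(f)$ for all continuous compactly supported $f$. $M_c^\natural(G)$ is the set of compactly supported $K$-bi-invariant complex Radon measures. $(G,K)$ is a (hypergroup) Gelfand pair if $(M_c^\natural(G),\ast)$ is commutative. Dual and Fourier transform. $\widehat{G^\natural}$ is the set of bounded continuous $K$-bi-invariant functions $\phi:G\to\mathbb{C}$ with $\phi(e)=1$, $\int_K\phi(x\ast k\ast y)\,dk=\phi(x)\phi(y)$ and $\phi(x^\diamond)=\overline{\phi(x)}$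 for all $x,y\in G$, with the topology of uniform convergence on compact sets (it is locally compact Hausdorff). For a $K$-bi-invariant integrable $f$, $\widehat f(\phi)=\int_G\phi(x^\diamond)f(x)\,dx$ for $\phi\in\widehat{G^\natural}$. $\pi$ denotes the Plancherel measure: the unique nonnegative measure on $\widehat{G^\natural}$ such that $\int_G|f(x)|^2dx=\int_{\widehat{G^\natural}}|\widehat f(\phi)|^2d\pi(\phi)$ for all $K$-bi-invariant $f\in L^1(G)\cap L^2(G)$. Let $L^{2,\natural}(G)$ be the space of $K$-bi-invariant functions in $L^2(G)$ and $L^2(\widehat{G^\natural})=L^2(\widehat{G^\natural},\pi)$. It is a known fact that the Fourier transform extends to an isometric isomorphism, still written $f\mapsto\widehat f$, from $L^{2,\natural}(G)$ onto $L^2(\widehat{G^\natural})$. Sobolev space. For a real number $s>0$, $H^{s,\natural}_\gamma(G)=\{f\in L^{2,\natural}(G):\int_{\widehat{G^\natural}}(1+\gamma(\phi)^2)^s|\widehat f(\phi)|^2d\pi(\phi)<\infty\}$, with norm $\|f\|_{H^{s,\natural}_\gamma}=\left(\int_{\widehat{G^\natural}}(1+\gamma(\phi)^2)^s|\widehat f(\phi)|^2d\pi(\phi)\right)^{1/2}$. *)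

theory Defs
  imports "HOL-Analysis.Analysis"
begin

text \<open>
  The hypergroup is the whole of a type of class \<^class>\<open>t2_space\<close>; local compactness is an
  axiom of the locale below.  Nonnegative, possibly unbounded, Radon measures are library
  measures.  Bounded complex Radon measures, for which the library has no type, are the
  regular countably additive set functions on the Borel sets.
\<close>

section \<open>Radon measures\<close>

definition radon_measure_on :: "'a topology \<Rightarrow> 'a measure \<Rightarrow> bool" where
  "radon_measure_on T M \<longleftrightarrow>
     space M = topspace T \<and>
     sets M = sigma_sets (topspace T) {U. openin T U} \<and>
     (\<forall>C. compactin T C \<longrightarrow> emeasure M C < \<infinity>) \<and>
     (\<forall>A\<in>sets M. emeasure M A = (INF U\<in>{U. openin T U \<and> A \<subseteq> U}. emeasure M U)) \<and>
     (\<forall>U. openin T U \<longrightarrow> emeasure M U = (SUP C\<in>{C. compactin T C \<and> C \<subseteq> U}. emeasure M C))"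

type_synonym 'g cmeas = "'g set \<Rightarrow> complex"

text \<open>
  The value on non-Borel sets is fixed to be 0, so that equality of measures is equality of
  functions.  The last clause is inner regularity of the total variation.
\<close>
definition Mb :: "'g::t2_space cmeas set" where
  "Mb = {\<mu>. (\<forall>A. A \<notin> sets borel \<longrightarrow> \<mu> A = 0) \<and>
            (\<forall>A :: nat \<Rightarrow> 'g set. range A \<subseteq> sets borel \<longrightarrow> disjoint_family A \<longrightarrow>
                (\<lambda>n. \<mu> (A n)) sums \<mu> (\<Union>n. A n)) \<and>
            (\<forall>A\<in>sets borel. \<forall>\<epsilon>>0. \<exists>C. compact C \<and> C \<subseteq> A \<and>
                (\<forall>B\<in>sets borel. B \<subseteq> A - C \<longrightarrow> cmod (\<mu> B) < \<epsilon>))}"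

definition Mb_plus :: "'g::t2_space cmeas set" where
  "Mb_plus = {\<mu>\<in>Mb. \<forall>A. Im (\<mu> A) = 0 \<and> Re (\<mu> A) \<ge> 0}"

definition point_mass :: "'g::t2_space \<Rightarrow> 'g cmeas" where
  "point_mass x = (\<lambda>A. if A \<in> sets borel \<and> x \<in> A then 1 else 0)"

text \<open>
  The positive part of the real part of \<open>\<mu>\<close>, by the Jordan formula
  \<open>(Re \<mu>)\<^sup>+ A = sup {Re (\<mu> B) | B \<subseteq> A}\<close>.
\<close>
definition pos_part :: "'g::t2_space cmeas \<Rightarrow> 'g measure" where
  "pos_part \<mu> = measure_of UNIV (sets borel)
     (\<lambda>A. SUP B\<in>{B\<in>sets borel. B \<subseteq> A}. ennreal (Re (\<mu> B)))"

text \<open>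
  Since \<open>\<mu> = (Re \<mu>)\<^sup>+ - (Re \<mu>)\<^sup>- + \<i> (Im \<mu>)\<^sup>+ - \<i> (Im \<mu>)\<^sup>-\<close>, and the four measures are the
  positive parts of the real parts of \<open>\<mu>\<close>, \<open>-\<mu>\<close>, \<open>-\<i> \<mu>\<close> and \<open>\<i> \<mu>\<close>.
\<close>
definition cintegral :: "'g::t2_space cmeas \<Rightarrow> ('g \<Rightarrow> complex) \<Rightarrow> complex" where
  "cintegral \<mu> f =
     (\<integral>x. f x \<partial>pos_part \<mu>) - (\<integral>x. f x \<partial>pos_part (\<lambda>A. - \<mu> A))
     + \<i> * (\<integral>x. f x \<partial>pos_part (\<lambda>A. - \<i> * \<mu> A)) - \<i> * (\<integral>x. f x \<partial>pos_part (\<lambda>A. \<i> * \<mu> A))"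

definition cintegrable :: "'g::t2_space cmeas \<Rightarrow> ('g \<Rightarrow> complex) \<Rightarrow> bool" where
  "cintegrable \<mu> f \<longleftrightarrow>
     integrable (pos_part \<mu>) f \<and> integrable (pos_part (\<lambda>A. - \<mu> A)) f \<and>
     integrable (pos_part (\<lambda>A. - \<i> * \<mu> A)) f \<and> integrable (pos_part (\<lambda>A. \<i> * \<mu> A)) f"

definition csupp :: "'g::t2_space cmeas \<Rightarrow> 'g set" where
  "csupp \<mu> = {x. \<forall>U. open U \<and> x \<in> U \<longrightarrow> (\<exists>B\<in>sets borel. B \<subseteq> U \<and> \<mu> B \<noteq> 0)}"

definition Cc :: "('g::t2_space \<Rightarrow> complex) set" where
  "Cc = {f. continuous_on UNIV f \<and> compact (closure {x. f x \<noteq> 0})}"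

definition cone_topology :: "'g::t2_space cmeas topology" where
  "cone_topology = topology_generated_by
     {{\<mu>\<in>Mb_plus. cintegral \<mu> f \<in> U} | f U. f \<in> insert (\<lambda>_. 1) Cc \<and> open U}"

definition michael_topology :: "'g::t2_space set topology" where
  "michael_topology = topology_generated_by
     ({{C. compact C \<and> C \<inter> U \<noteq> {}} | U. open U} \<union> {{C. compact C \<and> C \<subseteq> U} | U. open U})"

section \<open>Hypergroups\<close>

text \<open>
  \<open>conv\<close> only matters on \<^const>\<open>Mb\<close>.  The adjoint of a measure \<open>\<mu>\<close>, i.e. the measure with
  \<open>f \<mapsto> \<mu> (f \<circ> invol)\<close>, is the image measure \<open>A \<mapsto> \<mu> (invol -` A)\<close>.
\<close>
locale hypergroup =
  fixes conv :: "'g::t2_space cmeas \<Rightarrow> 'g cmeas \<Rightarrow> 'g cmeas"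
    and e :: 'g
    and invol :: "'g \<Rightarrow> 'g"
  assumes locally_compact: "locally_compact_space (euclidean :: 'g topology)"
    and conv_closed: "\<lbrakk>\<mu> \<in> Mb; \<nu> \<in> Mb\<rbrakk> \<Longrightarrow> conv \<mu> \<nu> \<in> Mb"
    and conv_assoc: "\<lbrakk>\<mu> \<in> Mb; \<nu> \<in> Mb; \<rho> \<in> Mb\<rbrakk> \<Longrightarrow> conv (conv \<mu> \<nu>) \<rho> = conv \<mu> (conv \<nu> \<rho>)"
    and conv_add_left: "\<lbrakk>\<mu> \<in> Mb; \<nu> \<in> Mb; \<rho> \<in> Mb\<rbrakk> \<Longrightarrow>
          conv (\<lambda>A. \<mu> A + \<nu> A) \<rho> = (\<lambda>A. conv \<mu> \<rho> A + conv \<nu> \<rho> A)"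
    and conv_add_right: "\<lbrakk>\<mu> \<in> Mb; \<nu> \<in> Mb; \<rho> \<in> Mb\<rbrakk> \<Longrightarrow>
          conv \<mu> (\<lambda>A. \<nu> A + \<rho> A) = (\<lambda>A. conv \<mu> \<nu> A + conv \<mu> \<rho> A)"
    and conv_scale_left: "\<lbrakk>\<mu> \<in> Mb; \<nu> \<in> Mb\<rbrakk> \<Longrightarrow>
          conv (\<lambda>A. c * \<mu> A) \<nu> = (\<lambda>A. c * conv \<mu> \<nu> A)"
    and conv_scale_right: "\<lbrakk>\<mu> \<in> Mb; \<nu> \<in> Mb\<rbrakk> \<Longrightarrow>
          conv \<mu> (\<lambda>A. c * \<nu> A) = (\<lambda>A. c * conv \<mu> \<nu> A)"
    and conv_continuous:
          "continuous_map (prod_topology cone_topology cone_topology) cone_topology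
             (\<lambda>(\<mu>, \<nu>). conv \<mu> \<nu>)"
    and conv_points_prob: "conv (point_mass x) (point_mass y) \<in> Mb_plus"
          "conv (point_mass x) (point_mass y) UNIV = 1"
    and conv_points_supp: "compact (csupp (conv (point_mass x) (point_mass y)))"
    and supp_continuous:
          "continuous_map euclidean michael_topology
             (\<lambda>(x, y). csupp (conv (point_mass x) (point_mass y)))"
    and unit: "conv (point_mass x) (point_mass e) = point_mass x"
          "conv (point_mass e) (point_mass x) = point_mass x"
    and unit_unique:
          "(\<And>x. conv (point_mass x) (point_mass e') = point_mass x \<and>
                conv (point_mass e') (point_mass x) = point_mass x) \<Longrightarrow> e' = e"
    and inv_continuous: "continuous_on UNIV invol"
    and inv_involutive: "invol (invol x) = x"
    and inv_conv: "(\<lambda>A. conv (point_mass x) (point_mass y) (invol -` A)) =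
          conv (point_mass (invol y)) (point_mass (invol x))"
    and inv_supp: "z \<in> csupp (conv (point_mass x) (point_mass y)) \<longleftrightarrow>
          x \<in> csupp (conv (point_mass z) (point_mass (invol y)))"

definition subhypergroup ::
  "('g::t2_space cmeas \<Rightarrow> 'g cmeas \<Rightarrow> 'g cmeas) \<Rightarrow> ('g \<Rightarrow> 'g) \<Rightarrow> 'g set \<Rightarrow> bool" where
  "subhypergroup conv invol H \<longleftrightarrow> H \<noteq> {} \<and> closed H \<and> (\<forall>x\<in>H. invol x \<in> H) \<and>
     (\<forall>x\<in>H. \<forall>y\<in>H. csupp (conv (point_mass x) (point_mass y)) \<subseteq> H)"

abbreviation conv3 ::
  "('g::t2_space cmeas \<Rightarrow> 'g cmeas \<Rightarrow> 'g cmeas) \<Rightarrow> 'g \<Rightarrow> 'g \<Rightarrow> 'g \<Rightarrow> 'g cmeas" where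
  "conv3 conv x y z \<equiv> conv (conv (point_mass x) (point_mass y)) (point_mass z)"

text \<open>\<open>f (x \<star> y)\<close> and \<open>f (x \<star> y \<star> z)\<close>.\<close>

definition at2 ::
  "('g::t2_space cmeas \<Rightarrow> 'g cmeas \<Rightarrow> 'g cmeas) \<Rightarrow> ('g \<Rightarrow> complex) \<Rightarrow> 'g \<Rightarrow> 'g \<Rightarrow> complex" where
  "at2 conv f x y = cintegral (conv (point_mass x) (point_mass y)) f"

definition at3 ::
  "('g::t2_space cmeas \<Rightarrow> 'g cmeas \<Rightarrow> 'g cmeas) \<Rightarrow> ('g \<Rightarrow> complex) \<Rightarrow> 'g \<Rightarrow> 'g \<Rightarrow> 'g \<Rightarrow> complex"
  where "at3 conv f x y z = cintegral (conv3 conv x y z) f"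

definition left_haar_measure ::
  "('g::t2_space cmeas \<Rightarrow> 'g cmeas \<Rightarrow> 'g cmeas) \<Rightarrow> 'g measure \<Rightarrow> bool" where
  "left_haar_measure conv dx \<longleftrightarrow> radon_measure_on euclidean dx \<and> emeasure dx UNIV \<noteq> 0 \<and>
     (\<forall>y. \<forall>f\<in>Cc. (\<integral>x. at2 conv f y x \<partial>dx) = (\<integral>x. f x \<partial>dx))"

text \<open>
  The Haar measure of a compact subhypergroup \<open>K\<close> is a measure on the whole space that is
  concentrated on \<open>K\<close>.  Continuous functions on \<open>K\<close> are exactly the restrictions of functions
  in \<^const>\<open>Cc\<close>, and for \<open>k\<^sub>0, k \<in> K\<close> the value of \<open>f (k\<^sub>0 \<star> k)\<close> depends only on \<open>f\<close> on \<open>K\<close>.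
\<close>
definition normalized_haar_measure ::
  "('g::t2_space cmeas \<Rightarrow> 'g cmeas \<Rightarrow> 'g cmeas) \<Rightarrow> 'g set \<Rightarrow> 'g measure \<Rightarrow> bool" where
  "normalized_haar_measure conv K dk \<longleftrightarrow>
     radon_measure_on euclidean dk \<and> emeasure dk (- K) = 0 \<and> emeasure dk K = 1 \<and>
     (\<forall>k\<^sub>0\<in>K. \<forall>f\<in>Cc. (LINT k:K|dk. at2 conv f k\<^sub>0 k) = (LINT k:K|dk. f k))"

section \<open>Gelfand pairs\<close>

definition bi_invariant ::
  "('g::t2_space cmeas \<Rightarrow> 'g cmeas \<Rightarrow> 'g cmeas) \<Rightarrow> 'g set \<Rightarrow> ('g \<Rightarrow> complex) \<Rightarrow> bool" where
  "bi_invariant conv K f \<longleftrightarrow> (\<forall>k\<^sub>1\<in>K. \<forall>k\<^sub>2\<in>K. \<forall>x. at3 conv f k\<^sub>1 x k\<^sub>2 = f x)"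

text \<open>
  Integrability is required because the integral of a non-integrable function is 0 by
  convention; for \<open>p\<close>-integrable \<open>f\<close> it holds almost everywhere.
\<close>
definition bi_invariant_AE ::
  "('g::t2_space cmeas \<Rightarrow> 'g cmeas \<Rightarrow> 'g cmeas) \<Rightarrow> 'g measure \<Rightarrow> 'g set \<Rightarrow> ('g \<Rightarrow> complex) \<Rightarrow> bool"
  where
  "bi_invariant_AE conv dx K f \<longleftrightarrow> (\<forall>k\<^sub>1\<in>K. \<forall>k\<^sub>2\<in>K. AE x in dx.
     cintegrable (conv3 conv k\<^sub>1 x k\<^sub>2) f \<and> at3 conv f k\<^sub>1 x k\<^sub>2 = f x)"

definition natural_proj ::
  "('g::t2_space cmeas \<Rightarrow> 'g cmeas \<Rightarrow> 'g cmeas) \<Rightarrow> 'g set \<Rightarrow> 'g measure \<Rightarrow>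
   ('g \<Rightarrow> complex) \<Rightarrow> 'g \<Rightarrow> complex" where
  "natural_proj conv K dk f x = (LINT k\<^sub>2:K|dk. (LINT k\<^sub>1:K|dk. at3 conv f k\<^sub>1 x k\<^sub>2))"

text \<open>A compactly supported complex Radon measure is bounded, hence the use of \<^const>\<open>Mb\<close>.\<close>
definition Mc_natural ::
  "('g::t2_space cmeas \<Rightarrow> 'g cmeas \<Rightarrow> 'g cmeas) \<Rightarrow> 'g set \<Rightarrow> 'g measure \<Rightarrow> 'g cmeas set" where
  "Mc_natural conv K dk = {\<mu>\<in>Mb. compact (csupp \<mu>) \<and>
     (\<forall>f\<in>Cc. cintegral \<mu> (natural_proj conv K dk f) = cintegral \<mu> f)}"

definition gelfand_pair ::
  "('g::t2_space cmeas \<Rightarrow> 'g cmeas \<Rightarrow> 'g cmeas) \<Rightarrow> 'g \<Rightarrow> ('g \<Rightarrow> 'g) \<Rightarrow> 'g measure \<Rightarrow>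
   'g set \<Rightarrow> 'g measure \<Rightarrow> bool" where
  "gelfand_pair conv e invol dx K dk \<longleftrightarrow>
     hypergroup conv e invol \<and> left_haar_measure conv dx \<and>
     subhypergroup conv invol K \<and> compact K \<and> normalized_haar_measure conv K dk \<and>
     (\<forall>\<mu>\<in>Mc_natural conv K dk. \<forall>\<nu>\<in>Mc_natural conv K dk. conv \<mu> \<nu> = conv \<nu> \<mu>)"

section \<open>Dual space and Fourier transform\<close>

definition dual_space ::
  "('g::t2_space cmeas \<Rightarrow> 'g cmeas \<Rightarrow> 'g cmeas) \<Rightarrow> 'g \<Rightarrow> ('g \<Rightarrow> 'g) \<Rightarrow> 'g set \<Rightarrow> 'g measure \<Rightarrow>
   ('g \<Rightarrow> complex) set" where
  "dual_space conv e invol K dk = {\<phi>.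
     bounded (range \<phi>) \<and> continuous_on UNIV \<phi> \<and> bi_invariant conv K \<phi> \<and> \<phi> e = 1 \<and>
     (\<forall>x y. (LINT k:K|dk. at3 conv \<phi> x k y) = \<phi> x * \<phi> y) \<and>
     (\<forall>x. \<phi> (invol x) = cnj (\<phi> x))}"

text \<open>
  On a set of continuous functions, the sets below generate the topology of uniform
  convergence on compact sets.
\<close>
definition compact_convergence_topology ::
  "('g::t2_space \<Rightarrow> complex) set \<Rightarrow> ('g \<Rightarrow> complex) topology" where
  "compact_convergence_topology D = topology_generated_by
     {{\<psi>\<in>D. \<forall>x\<in>C. dist (\<psi> x) (\<phi> x) < \<epsilon>} | \<phi> C \<epsilon>. \<phi> \<in> D \<and> compact C \<and> \<epsilon> > 0}"

definition L1_natural ::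
  "('g::t2_space cmeas \<Rightarrow> 'g cmeas \<Rightarrow> 'g cmeas) \<Rightarrow> 'g measure \<Rightarrow> 'g set \<Rightarrow> ('g \<Rightarrow> complex) set"
  where
  "L1_natural conv dx K = {f. integrable dx f \<and> bi_invariant_AE conv dx K f}"

definition L2_natural ::
  "('g::t2_space cmeas \<Rightarrow> 'g cmeas \<Rightarrow> 'g cmeas) \<Rightarrow> 'g measure \<Rightarrow> 'g set \<Rightarrow> ('g \<Rightarrow> complex) set"
  where
  "L2_natural conv dx K = {f. f \<in> borel_measurable dx \<and> integrable dx (\<lambda>x. (cmod (f x))\<^sup>2) \<and>
     bi_invariant_AE conv dx K f}"

definition fourier ::
  "('g \<Rightarrow> 'g) \<Rightarrow> 'g measure \<Rightarrow> ('g \<Rightarrow> complex) \<Rightarrow> ('g \<Rightarrow> complex) \<Rightarrow> complex" where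
  "fourier invol dx f \<phi> = (\<integral>x. \<phi> (invol x) * f x \<partial>dx)"

definition plancherel_measure ::
  "('g::t2_space cmeas \<Rightarrow> 'g cmeas \<Rightarrow> 'g cmeas) \<Rightarrow> 'g \<Rightarrow> ('g \<Rightarrow> 'g) \<Rightarrow> 'g measure \<Rightarrow>
   'g set \<Rightarrow> 'g measure \<Rightarrow> ('g \<Rightarrow> complex) measure \<Rightarrow> bool" where
  "plancherel_measure conv e invol dx K dk \<pi> \<longleftrightarrow>
     radon_measure_on (compact_convergence_topology (dual_space conv e invol K dk)) \<pi> \<and>
     (\<forall>f \<in> L1_natural conv dx K \<inter> L2_natural conv dx K.
        (\<integral>\<^sup>+x. (cmod (f x))\<^sup>2 \<partial>dx) = (\<integral>\<^sup>+\<phi>. (cmod (fourier invol dx f \<phi>))\<^sup>2 \<partial>\<pi>))"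

text \<open>
  \<open>F\<close> is the extension of the Fourier transform to an isometric isomorphism of the
  \<open>L\<^sup>2\<close>-spaces.  Elements of these spaces are represented by functions, hence the
  identities almost everywhere; the extension is unique up to null sets.
\<close>
definition plancherel_transform ::
  "('g::t2_space cmeas \<Rightarrow> 'g cmeas \<Rightarrow> 'g cmeas) \<Rightarrow> ('g \<Rightarrow> 'g) \<Rightarrow> 'g measure \<Rightarrow> 'g set \<Rightarrow>
   ('g \<Rightarrow> complex) measure \<Rightarrow> (('g \<Rightarrow> complex) \<Rightarrow> (('g \<Rightarrow> complex) \<Rightarrow> complex)) \<Rightarrow> bool" where
  "plancherel_transform conv invol dx K \<pi> F \<longleftrightarrow>
     (\<forall>f \<in> L1_natural conv dx K \<inter> L2_natural conv dx K. AE \<phi> in \<pi>. F f \<phi> = fourier invol dx f \<phi>) \<and>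
     (\<forall>f \<in> L2_natural conv dx K.
        F f \<in> borel_measurable \<pi> \<and> integrable \<pi> (\<lambda>\<phi>. (cmod (F f \<phi>))\<^sup>2) \<and>
        (\<integral>\<phi>. (cmod (F f \<phi>))\<^sup>2 \<partial>\<pi>) = (\<integral>x. (cmod (f x))\<^sup>2 \<partial>dx)) \<and>
     (\<forall>f \<in> L2_natural conv dx K. \<forall>g \<in> L2_natural conv dx K. \<forall>a b. AE \<phi> in \<pi>.
        F (\<lambda>x. a * f x + b * g x) \<phi> = a * F f \<phi> + b * F g \<phi>) \<and>
     (\<forall>h \<in> borel_measurable \<pi>. integrable \<pi> (\<lambda>\<phi>. (cmod (h \<phi>))\<^sup>2) \<longrightarrow>
        (\<exists>f \<in> L2_natural conv dx K. AE \<phi> in \<pi>. F f \<phi> = h \<phi>))"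

section \<open>Sobolev spaces\<close>

definition sobolev_space ::
  "('g::t2_space cmeas \<Rightarrow> 'g cmeas \<Rightarrow> 'g cmeas) \<Rightarrow> 'g measure \<Rightarrow> 'g set \<Rightarrow>
   ('g \<Rightarrow> complex) measure \<Rightarrow> (('g \<Rightarrow> complex) \<Rightarrow> (('g \<Rightarrow> complex) \<Rightarrow> complex)) \<Rightarrow>
   (('g \<Rightarrow> complex) \<Rightarrow> real) \<Rightarrow> real \<Rightarrow> ('g \<Rightarrow> complex) set" where
  "sobolev_space conv dx K \<pi> F \<gamma> s = {f \<in> L2_natural conv dx K.
     integrable \<pi> (\<lambda>\<phi>. (1 + (\<gamma> \<phi>)\<^sup>2) powr s * (cmod (F f \<phi>))\<^sup>2)}"

definition sobolev_norm ::
  "('g \<Rightarrow> complex) measure \<Rightarrow> (('g \<Rightarrow> complex) \<Rightarrow> (('g \<Rightarrow> complex) \<Rightarrow> complex)) \<Rightarrow>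
   (('g \<Rightarrow> complex) \<Rightarrow> real) \<Rightarrow> real \<Rightarrow> ('g \<Rightarrow> complex) \<Rightarrow> real" where
  "sobolev_norm \<pi> F \<gamma> s f = sqrt (\<integral>\<phi>. (1 + (\<gamma> \<phi>)\<^sup>2) powr s * (cmod (F f \<phi>))\<^sup>2 \<partial>\<pi>)"

text \<open>
  \<open>X \<subseteq> Y\<close>, and the inclusion is continuous for the (semi)norms \<open>p\<close> on \<open>X\<close> and \<open>q\<close> on \<open>Y\<close>.
\<close>
definition continuously_embedded ::
  "('a \<Rightarrow> complex) set \<Rightarrow> (('a \<Rightarrow> complex) \<Rightarrow> real) \<Rightarrow>
   ('a \<Rightarrow> complex) set \<Rightarrow> (('a \<Rightarrow> complex) \<Rightarrow> real) \<Rightarrow> bool" where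
  "continuously_embedded X p Y q \<longleftrightarrow> X \<subseteq> Y \<and>
     (\<forall>f\<in>X. \<forall>\<epsilon>>0. \<exists>\<delta>>0. \<forall>g\<in>X. p (\<lambda>x. g x - f x) < \<delta> \<longrightarrow> q (\<lambda>x. g x - f x) < \<epsilon>)"

end

theory Submission
  imports Defs
begin

text \<open>
  Since \<open>1 + \<gamma>\<^sup>2 \<ge> 1\<close>, the weight \<open>(1 + \<gamma>\<^sup>2)\<^sup>\<sigma>\<close> is dominated by \<open>(1 + \<gamma>\<^sup>2)\<^sup>s\<close>, which gives the
  inclusion and the norm inequality.  By linearity of the Plancherel transform, \<open>H\<^sup>s\<close> is closed
  under differences, so the norm inequality applies to \<open>g - f\<close> and yields continuity.
\<close>

lemma norm_diff_squared_le:
  fixes a b :: "'a::real_normed_vector"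
  shows "(norm (a - b))\<^sup>2 \<le> 2 * (norm a)\<^sup>2 + 2 * (norm b)\<^sup>2"
proof -
  have "(norm (a - b))\<^sup>2 \<le> (norm a + norm b)\<^sup>2"
    by (intro power_mono norm_triangle_ineq4) simp
  \<comment> \<open>After expansion, the bound is
    \<open>0 \<le> (norm a - norm b)\<^sup>2\<close>.\<close>
  also have "\<dots> \<le> 2 * (norm a)\<^sup>2 + 2 * (norm b)\<^sup>2"
    using zero_le_power2[of "norm a - norm b"] by (simp add: power2_sum power2_diff)
  finally show ?thesis .
qed

text \<open>Twice the sum of the two given integrands is an integrable majorant. Applied below with
  weight 1 on the group side and with the Sobolev weight on the dual side.\<close>

lemma integrable_weighted_norm_diff_squared:
  fixes f g :: "'a \<Rightarrow> 'b::{second_countable_topology, real_normed_vector}"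
  assumes [measurable]: "w \<in> borel_measurable M" "f \<in> borel_measurable M" "g \<in> borel_measurable M"
    and w: "\<And>x. w x \<ge> 0"
    and f: "integrable M (\<lambda>x. w x * (norm (f x))\<^sup>2)"
    and g: "integrable M (\<lambda>x. w x * (norm (g x))\<^sup>2)"
  shows "integrable M (\<lambda>x. w x * (norm (f x - g x))\<^sup>2)"
proof (rule Bochner_Integration.integrable_bound)
  show "integrable M (\<lambda>x. 2 * (w x * (norm (f x))\<^sup>2) + 2 * (w x * (norm (g x))\<^sup>2))"
    using f g by simp
  show "AE x in M. norm (w x * (norm (f x - g x))\<^sup>2)
      \<le> norm (2 * (w x * (norm (f x))\<^sup>2) + 2 * (w x * (norm (g x))\<^sup>2))"
  proof (rule AE_I2)
    fix x
    show "norm (w x * (norm (f x - g x))\<^sup>2)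
        \<le> norm (2 * (w x * (norm (f x))\<^sup>2) + 2 * (w x * (norm (g x))\<^sup>2))"
      using mult_left_mono[OF norm_diff_squared_le[of "f x" "g x"] w[of x]] w[of x]
      by (simp add: algebra_simps)
  qed
qed measurable

lemma cintegrable_diff:
  "\<lbrakk>cintegrable \<mu> f; cintegrable \<mu> g\<rbrakk> \<Longrightarrow> cintegrable \<mu> (\<lambda>x. f x - g x)"
  by (simp add: cintegrable_def)

text \<open>Each of the four integrals in \<open>cintegral\<close> splits separately. Integrability
  is essential, since a divergent integral counts as 0 and would break additivity.\<close>

lemma cintegral_diff:
  "\<lbrakk>cintegrable \<mu> f; cintegrable \<mu> g\<rbrakk> \<Longrightarrow>
    cintegral \<mu> (\<lambda>x. f x - g x) = cintegral \<mu> f - cintegral \<mu> g"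
  by (simp add: cintegrable_def cintegral_def algebra_simps)

text \<open>For a fixed pair \<open>k\<^sub>1\<close>, \<open>k\<^sub>2\<close>, the union of the
  two exceptional null sets is null. Outside it, the integrability clause of
  \<open>bi_invariant_AE\<close> permits splitting the integral of \<open>f - g\<close>.\<close>

lemma bi_invariant_AE_diff:
  assumes "bi_invariant_AE conv dx K f" "bi_invariant_AE conv dx K g"
  shows "bi_invariant_AE conv dx K (\<lambda>x. f x - g x)"
  unfolding bi_invariant_AE_def
proof (intro ballI)
  fix k\<^sub>1 k\<^sub>2 assume "k\<^sub>1 \<in> K" "k\<^sub>2 \<in> K"
  then have
    "AE x in dx. cintegrable (conv3 conv k\<^sub>1 x k\<^sub>2) f \<and> at3 conv f k\<^sub>1 x k\<^sub>2 = f x"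
    "AE x in dx. cintegrable (conv3 conv k\<^sub>1 x k\<^sub>2) g \<and> at3 conv g k\<^sub>1 x k\<^sub>2 = g x"
    using assms by (auto simp: bi_invariant_AE_def)
  then show "AE x in dx. cintegrable (conv3 conv k\<^sub>1 x k\<^sub>2) (\<lambda>x. f x - g x) \<and>
      at3 conv (\<lambda>x. f x - g x) k\<^sub>1 x k\<^sub>2 = f x - g x"
    by eventually_elim (auto simp: at3_def cintegrable_diff cintegral_diff)
qed

lemma L2_natural_diff:
  assumes "f \<in> L2_natural conv dx K" "g \<in> L2_natural conv dx K"
  shows "(\<lambda>x. f x - g x) \<in> L2_natural conv dx K"
  using assms integrable_weighted_norm_diff_squared[of "\<lambda>_. 1" dx f g]
  by (auto simp: L2_natural_def bi_invariant_AE_diff)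

lemma
  assumes "plancherel_transform conv invol dx K \<pi> F"
  shows plancherel_transform_measurable:
      "f \<in> L2_natural conv dx K \<Longrightarrow> F f \<in> borel_measurable \<pi>"
    and plancherel_transform_diff:
      "\<lbrakk>f \<in> L2_natural conv dx K; g \<in> L2_natural conv dx K\<rbrakk> \<Longrightarrow>
        AE \<phi> in \<pi>. F (\<lambda>x. f x - g x) \<phi> = F f \<phi> - F g \<phi>"
proof -
  show "f \<in> L2_natural conv dx K \<Longrightarrow> F f \<in> borel_measurable \<pi>"
    using assms by (auto simp: plancherel_transform_def)
  assume "f \<in> L2_natural conv dx K" "g \<in> L2_natural conv dx K"
  \<comment> \<open>Linearity with coefficients 1 and -1. It holds only almost everywhere, because
    \<open>F\<close> picks representatives of classes in \<open>L\<^sup>2\<close>.\<close>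
  then have "AE \<phi> in \<pi>. F (\<lambda>x. 1 * f x + (- 1) * g x) \<phi> = 1 * F f \<phi> + (- 1) * F g \<phi>"
    using assms unfolding plancherel_transform_def by blast
  then show "AE \<phi> in \<pi>. F (\<lambda>x. f x - g x) \<phi> = F f \<phi> - F g \<phi>"
    by simp
qed

text \<open>Integrability is shown first for the pointwise difference \<open>F f - F g\<close>, then
  transferred to the transform of \<open>f - g\<close>, which agrees with it almost
  everywhere.\<close>

lemma sobolev_space_diff:
  assumes F: "plancherel_transform conv invol dx K \<pi> F"
    and [measurable]: "\<gamma> \<in> borel_measurable \<pi>"
    and f: "f \<in> sobolev_space conv dx K \<pi> F \<gamma> s"
    and g: "g \<in> sobolev_space conv dx K \<pi> F \<gamma> s"
  shows "(\<lambda>x. f x - g x) \<in> sobolev_space conv dx K \<pi> F \<gamma> s"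
proof -
  let ?w = "\<lambda>\<phi>. (1 + (\<gamma> \<phi>)\<^sup>2) powr s"
  have L2: "f \<in> L2_natural conv dx K" "g \<in> L2_natural conv dx K"
    using f g by (auto simp: sobolev_space_def)
  have diff: "(\<lambda>x. f x - g x) \<in> L2_natural conv dx K"
    using L2 by (rule L2_natural_diff)
  note [measurable] = L2[THEN plancherel_transform_measurable[OF F]]
    plancherel_transform_measurable[OF F diff]
  have int: "integrable \<pi> (\<lambda>\<phi>. ?w \<phi> * (cmod (F f \<phi> - F g \<phi>))\<^sup>2)"
    using f g by (intro integrable_weighted_norm_diff_squared) (auto simp: sobolev_space_def)
  have AE: "AE \<phi> in \<pi>. ?w \<phi> * (cmod (F f \<phi> - F g \<phi>))\<^sup>2
      = ?w \<phi> * (cmod (F (\<lambda>x. f x - g x) \<phi>))\<^sup>2"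
    using plancherel_transform_diff[OF F L2] by eventually_elim simp
  \<comment> \<open>Integrability passes between almost everywhere equal functions once both are
    measurable; for the transform of \<open>f - g\<close> this comes from
    \<open>diff\<close>.\<close>
  have "integrable \<pi> (\<lambda>\<phi>. ?w \<phi> * (cmod (F (\<lambda>x. f x - g x) \<phi>))\<^sup>2)"
    by (rule integrable_cong_AE_imp[OF int _ AE]) measurable
  with diff show ?thesis
    by (simp add: sobolev_space_def)
qed

lemma sobolev_weight_mono:
  fixes c :: real
  assumes "\<sigma> \<le> s"
  shows "(1 + c\<^sup>2) powr \<sigma> * (cmod z)\<^sup>2 \<le> (1 + c\<^sup>2) powr s * (cmod z)\<^sup>2"
  using assms by (intro mult_right_mono powr_mono) auto

lemma sobolev_space_antimono:
  assumes F: "plancherel_transform conv invol dx K \<pi> F"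
    and [measurable]: "\<gamma> \<in> borel_measurable \<pi>"
    and "\<sigma> \<le> s"
  shows "sobolev_space conv dx K \<pi> F \<gamma> s \<subseteq> sobolev_space conv dx K \<pi> F \<gamma> \<sigma>"
proof
  fix f assume f: "f \<in> sobolev_space conv dx K \<pi> F \<gamma> s"
  then have L2: "f \<in> L2_natural conv dx K"
    by (simp add: sobolev_space_def)
  note [measurable] = plancherel_transform_measurable[OF F L2]
  have "integrable \<pi> (\<lambda>\<phi>. (1 + (\<gamma> \<phi>)\<^sup>2) powr \<sigma> * (cmod (F f \<phi>))\<^sup>2)"
  \<comment> \<open>The majorant is the integrand with exponent \<open>s\<close>.\<close>
  proof (rule Bochner_Integration.integrable_bound)
    show "integrable \<pi> (\<lambda>\<phi>. (1 + (\<gamma> \<phi>)\<^sup>2) powr s * (cmod (F f \<phi>))\<^sup>2)"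
      using f by (simp add: sobolev_space_def)
  qed (auto simp: sobolev_weight_mono[OF \<open>\<sigma> \<le> s\<close>])
  with L2 show "f \<in> sobolev_space conv dx K \<pi> F \<gamma> \<sigma>"
    by (simp add: sobolev_space_def)
qed

lemma sobolev_norm_mono:
  assumes "plancherel_transform conv invol dx K \<pi> F" "\<gamma> \<in> borel_measurable \<pi>" "\<sigma> \<le> s"
    and f: "f \<in> sobolev_space conv dx K \<pi> F \<gamma> s"
  shows "sobolev_norm \<pi> F \<gamma> \<sigma> f \<le> sobolev_norm \<pi> F \<gamma> s f"
proof -
  \<comment> \<open>The inclusion comes first because \<open>integral_mono\<close> requires both
    integrands to be integrable.\<close>
  have "f \<in> sobolev_space conv dx K \<pi> F \<gamma> \<sigma>"
    using sobolev_space_antimono[OF assms(1-3)] f by blast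
  with f show ?thesis
    unfolding sobolev_norm_def
    by (intro real_sqrt_le_mono integral_mono sobolev_weight_mono[OF \<open>\<sigma> \<le> s\<close>])
      (auto simp: sobolev_space_def)
qed

theorem theorem3p5:
  fixes conv :: "'g::t2_space cmeas \<Rightarrow> 'g cmeas \<Rightarrow> 'g cmeas"
    and e :: 'g and invol :: "'g \<Rightarrow> 'g" and dx :: "'g measure"
    and K :: "'g set" and dk :: "'g measure"
    and \<pi> :: "('g \<Rightarrow> complex) measure"
    and F :: "('g \<Rightarrow> complex) \<Rightarrow> ('g \<Rightarrow> complex) \<Rightarrow> complex"
    and \<gamma> :: "('g \<Rightarrow> complex) \<Rightarrow> real"
    and s \<sigma> :: real
  assumes "gelfand_pair conv e invol dx K dk"
    and "plancherel_measure conv e invol dx K dk \<pi>"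
    and "plancherel_transform conv invol dx K \<pi> F"
    and "\<gamma> \<in> borel_measurable \<pi>"
    and "\<And>\<phi>. \<phi> \<in> dual_space conv e invol K dk \<Longrightarrow> \<gamma> \<phi> \<ge> 0"
    and "s > \<sigma>" and "\<sigma> > 0"
  shows "continuously_embedded
           (sobolev_space conv dx K \<pi> F \<gamma> s) (sobolev_norm \<pi> F \<gamma> s)
           (sobolev_space conv dx K \<pi> F \<gamma> \<sigma>) (sobolev_norm \<pi> F \<gamma> \<sigma>) \<and>
         (\<forall>f \<in> sobolev_space conv dx K \<pi> F \<gamma> s.
            sobolev_norm \<pi> F \<gamma> \<sigma> f \<le> sobolev_norm \<pi> F \<gamma> s f)"
proof -
  note F = \<open>plancherel_transform conv invol dx K \<pi> F\<close>
    and \<gamma> = \<open>\<gamma> \<in> borel_measurable \<pi>\<close>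
  have "\<sigma> \<le> s" using \<open>s > \<sigma>\<close> by simp
  note mono = sobolev_norm_mono[OF F \<gamma> this]
  \<comment> \<open>The choice \<open>\<delta> = \<epsilon>\<close> works for every
    \<open>f\<close>: the embedding has norm at most 1, and \<open>g - f\<close> again lies in the
    space with exponent \<open>s\<close>.\<close>
  have "\<exists>\<delta>>0. \<forall>g\<in>sobolev_space conv dx K \<pi> F \<gamma> s.
      sobolev_norm \<pi> F \<gamma> s (\<lambda>x. g x - f x) < \<delta> \<longrightarrow> sobolev_norm \<pi> F \<gamma> \<sigma> (\<lambda>x. g x - f x) < \<epsilon>"
    if "f \<in> sobolev_space conv dx K \<pi> F \<gamma> s" "\<epsilon> > 0" for f \<epsilon>
    using that mono[OF sobolev_space_diff[OF F \<gamma>]] by (meson le_less_trans)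
  then show ?thesis
    using sobolev_space_antimono[OF F \<gamma> \<open>\<sigma> \<le> s\<close>] mono
    by (auto simp: continuously_embedded_def)
qed

end
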